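(* Let $D=(F,R,>)$ be a decisive defeasible theory. Then for each literal $p$: (a) $D\vdash+\Delta p$ or $D\vdash-\Delta p$; and (b) $D\vdash+\partial p$ or $D\vdash-\partial p$.
   Context: Literals are atoms $p$ or negated atoms $\neg p$; for a literal $q$, $\sim q$ is its complement. A defeasible theory $D=(F,R,>)$ consists of a finite set $F$ of literals (facts), a finite set $R$ of propositional rules, and a binary relation $>$ on $R$ whose transitive closure is irreflexive. Each rule $r$ has a unique label, an antecedent $A(r)$ (finite set of literals), a head $C(r)$ (a literal) and a kind: strict ($\to$), defeasible ($\Rightarrow$) or defeater ($\leadsto$). $R_s$: strict rules; $R_{sd}$: strict or defeasible rules; $R[q]$, $R_s[q]$, $R_{sd}[q]$: those with head $q$. A derivation in $D$ is a finite sequence $P(1),\dots,P(n)$ of tagged literals $+\Delta q,-\Delta q,+\partial q,-\partial q$ such that for each $i$ (with $P(1..i)$ the initial segment of length $i$): ($+\Delta$) if $P(i+1)=+\Delta q$ then $q\in F$ or $\exists r\in R_s[q]\,\forall a\in A(r):+\Delta a\in P(1..i)$; ($-\Delta$) if $P(i+1)=-\Delta q$ then $q\notin F$ and $\forall r\in R_s[q]\,\exists a\in A(r): -\Delta a\in P(1..i)$; ($+\partial$) if $P(i+1)=+\partial q$ then either $+\Delta q\in P(1..i)$, or: $\exists r\in R_{sd}[q]\,\forall a\in A(r):+\partial a\in P(1..i)$, and $-\Delta\sim q\in P(1..i)$, and for every $s\in R[\sim q]$ either $\exists a\in A(s):-\partial a\in P(1..i)$ or $\exists t\in R_{sd}[q]$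 with $t>s$ and $\forall a\in A(t):+\partial a\in P(1..i)$; ($-\partial$) if $P(i+1)=-\partial q$ then $-\Delta q\in P(1..i)$ and either $\forall r\in R_{sd}[q]\,\exists a\in A(r):-\partial a\in P(1..i)$, or $+\Delta\sim q\in P(1..i)$, or $\exists s\in R[\sim q]$ with $\forall a\in A(s):+\partial a\in P(1..i)$ and for every $t\in R_{sd}[q]$ either $\exists a\in A(t):-\partial a\in P(1..i)$ or $t\not> s$. $D\vdash L$ means $L$ occurs in some derivation in $D$. The dependency graph $DG(D)$ is the directed graph whose points are the sets $\{q,\sim q\}$ for literals $q$ in $D$, with an arc from $\{b,\sim b\}$ to $\{a,\sim a\}$ whenever there is a rule $r\in R[b]$ with $a\in A(r)$. $D$ is decisive iff $DG(D)$ is acyclic. *)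

theory Defs
  imports Main
begin

datatype 'a literal = Pos 'a | Neg 'a

fun compl :: "'a literal \<Rightarrow> 'a literal" where
  "compl (Pos a) = Neg a"
| "compl (Neg a) = Pos a"

datatype rule_kind = Strict | Defeasible | Defeater

record ('l, 'a) rule =
  label :: 'l
  kind :: rule_kind
  ante :: "'a literal set"
  head :: "'a literal"

text \<open>The pair \<open>(t, s)\<close> belongs to \<open>superiority\<close> iff \<open>t > s\<close>.\<close>

record ('l, 'a) dtheory =
  facts :: "'a literal set"
  rules :: "('l, 'a) rule set"
  superiority :: "(('l, 'a) rule \<times> ('l, 'a) rule) set"

definition defeasible_theory :: "('l, 'a) dtheory \<Rightarrow> bool" where
  "defeasible_theory D \<longleftrightarrow>
     finite (facts D) \<and>
     finite (rules D) \<and>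
     (\<forall>r\<in>rules D. finite (ante r)) \<and>
     inj_on label (rules D) \<and>
     superiority D \<subseteq> rules D \<times> rules D \<and>
     irrefl ((superiority D)\<^sup>+)"

definition R :: "('l, 'a) dtheory \<Rightarrow> 'a literal \<Rightarrow> ('l, 'a) rule set" where
  "R D q = {r \<in> rules D. head r = q}"

definition R_s :: "('l, 'a) dtheory \<Rightarrow> 'a literal \<Rightarrow> ('l, 'a) rule set" where
  "R_s D q = {r \<in> R D q. kind r = Strict}"

definition R_sd :: "('l, 'a) dtheory \<Rightarrow> 'a literal \<Rightarrow> ('l, 'a) rule set" where
  "R_sd D q = {r \<in> R D q. kind r = Strict \<or> kind r = Defeasible}"

datatype 'a tagged =
    PlusDelta "'a literal"     (\<open>+\<Delta>\<close>)
  | MinusDelta "'a literal"    (\<open>-\<Delta>\<close>)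
  | PlusPartial "'a literal"   (\<open>+\<partial>\<close>)
  | MinusPartial "'a literal"  (\<open>-\<partial>\<close>)

text \<open>\<open>step_ok D S L\<close>: the tagged literal \<open>L\<close> may come next in a derivation
  whose earlier elements form the set \<open>S\<close>.\<close>

fun step_ok :: "('l, 'a) dtheory \<Rightarrow> 'a tagged set \<Rightarrow> 'a tagged \<Rightarrow> bool" where
  "step_ok D S (+\<Delta> q) \<longleftrightarrow>
     q \<in> facts D \<or> (\<exists>r\<in>R_s D q. \<forall>a\<in>ante r. +\<Delta> a \<in> S)"
| "step_ok D S (-\<Delta> q) \<longleftrightarrow>
     q \<notin> facts D \<and> (\<forall>r\<in>R_s D q. \<exists>a\<in>ante r. -\<Delta> a \<in> S)"
| "step_ok D S (+\<partial> q) \<longleftrightarrow>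
     +\<Delta> q \<in> S \<or>
     ((\<exists>r\<in>R_sd D q. \<forall>a\<in>ante r. +\<partial> a \<in> S) \<and>
      -\<Delta> (compl q) \<in> S \<and>
      (\<forall>s\<in>R D (compl q).
         (\<exists>a\<in>ante s. -\<partial> a \<in> S) \<or>
         (\<exists>t\<in>R_sd D q. (t, s) \<in> superiority D \<and> (\<forall>a\<in>ante t. +\<partial> a \<in> S))))"
| "step_ok D S (-\<partial> q) \<longleftrightarrow>
     -\<Delta> q \<in> S \<and>
     ((\<forall>r\<in>R_sd D q. \<exists>a\<in>ante r. -\<partial> a \<in> S) \<or>
      +\<Delta> (compl q) \<in> S \<or>
      (\<exists>s\<in>R D (compl q).
         (\<forall>a\<in>ante s. +\<partial> a \<in> S) \<and>
         (\<forall>t\<in>R_sd D q. (\<exists>a\<in>ante t. -\<partial> a \<in> S) \<or> (t, s) \<notin> superiority D)))"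

definition derivation :: "('l, 'a) dtheory \<Rightarrow> 'a tagged list \<Rightarrow> bool" where
  "derivation D P \<longleftrightarrow> (\<forall>i<length P. step_ok D (set (take i P)) (P ! i))"

definition derivable :: "('l, 'a) dtheory \<Rightarrow> 'a tagged \<Rightarrow> bool"  (infix \<open>\<turnstile>\<close> 50) where
  "D \<turnstile> L \<longleftrightarrow> (\<exists>P. derivation D P \<and> L \<in> set P)"

definition literals :: "('l, 'a) dtheory \<Rightarrow> 'a literal set" where
  "literals D = facts D \<union> (\<Union>r\<in>rules D. insert (head r) (ante r))"

text \<open>The dependency graph, as a pair of its set of points and its set of arcs.\<close>

definition DG :: "('l, 'a) dtheory \<Rightarrow> 'a literal set set \<times> ('a literal set \<times> 'a literal set) set" where
  "DG D = ({{q, compl q} | q. q \<in> literals D},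
           {({b, compl b}, {a, compl a}) | a b. \<exists>r\<in>R D b. a \<in> ante r})"

text \<open>A loop counts as a cycle.\<close>

definition decisive :: "('l, 'a) dtheory \<Rightarrow> bool" where
  "decisive D \<longleftrightarrow> acyclic (snd (DG D))"

text \<open>Only the arcs enter into acyclicity; they do join points of the graph.\<close>

lemma DG_arcs: "snd (DG D) \<subseteq> fst (DG D) \<times> fst (DG D)"
  unfolding DG_def literals_def R_def by auto

end

(* The derivable tagged literals are closed under the inference conditions: only finitely many of
   them matter for one step, and their derivations can be concatenated. Acyclicity makes the finite
   dependency graph well-founded. By induction along it, all antecedents of rules for q and ~q are
   decided, and then the conditions for +\<Delta> q and -\<Delta> q, and likewise for
   +\<partial> q and -\<partial> q, are negations of each other. *)
theory Submission
  imports Defs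
begin

lemma compl_compl [simp]: "compl (compl q) = q"
  by (cases q) auto

text \<open>The conditions consult \<open>S\<close> only through positive membership: even the
  negative tags ask for the presence of tagged literals, never for their absence.\<close>

lemma step_ok_mono:
  assumes "step_ok D S L" and "S \<subseteq> T"
  shows "step_ok D T L"
proof -
  have "step_ok D S L \<longrightarrow> step_ok D T L"
    by (cases L; simp only: step_ok.simps Ball_def Bex_def)
      (rule imp_refl in_mono[OF assms(2)] conj_mono disj_mono ex_mono all_mono imp_mono)+
  then show ?thesis
    using assms(1) by blast
qed

lemma step_ok_finite_support:
  assumes "defeasible_theory D" and "step_ok D T L"
  obtains S where "finite S" "S \<subseteq> T" "step_ok D S L"
proof -
  obtain q where q: "L \<in> {+\<Delta> q, -\<Delta> q, +\<partial> q, -\<partial> q}"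
    by (cases L) auto
  \<comment> \<open>The conditions for \<open>L\<close> can consult only tags of these literals, so
    \<open>T \<inter> U\<close> suffices and is finite even if \<open>T\<close> is not.\<close>
  define Q where "Q = {q, compl q} \<union> (\<Union>r\<in>rules D. ante r)"
  define U where "U = +\<Delta> ` Q \<union> -\<Delta> ` Q \<union> +\<partial> ` Q \<union> -\<partial> ` Q"
  have "finite Q"
    using assms(1) by (auto simp: Q_def defeasible_theory_def)
  then have "finite (T \<inter> U)"
    by (simp add: U_def)
  moreover have mem: "+\<Delta> a \<in> U \<longleftrightarrow> a \<in> Q" "-\<Delta> a \<in> U \<longleftrightarrow> a \<in> Q"
      "+\<partial> a \<in> U \<longleftrightarrow> a \<in> Q" "-\<partial> a \<in> U \<longleftrightarrow> a \<in> Q" for a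
    by (auto simp: U_def)
  have "q \<in> Q" "compl q \<in> Q"
    by (auto simp: Q_def)
  moreover have ante: "a \<in> ante r \<Longrightarrow> r \<in> rules D \<Longrightarrow> a \<in> Q" for a r
    by (auto simp: Q_def)
  ultimately have "step_ok D (T \<inter> U) L"
    using q assms(2) by (elim insertE emptyE)
      (simp_all add: mem ante R_s_def R_sd_def R_def cong: ball_cong_simp bex_cong_simp)
  with \<open>finite (T \<inter> U)\<close> show thesis
    using that by blast
qed

text \<open>Elements of \<open>P'\<close> see all of \<open>P\<close> as additional earlier
  elements, which does no harm by monotonicity.\<close>

lemma derivation_append:
  assumes "derivation D P" and "derivation D P'"
  shows "derivation D (P @ P')"
  unfolding derivation_def
proof (intro allI impI)
  fix i assume i: "i < length (P @ P')"
  show "step_ok D (set (take i (P @ P'))) ((P @ P') ! i)"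
  proof (cases "i < length P")
    case True
    then show ?thesis
      using assms(1) by (simp add: derivation_def nth_append)
  next
    case False
    then have "step_ok D (set (take (i - length P) P')) ((P @ P') ! i)"
      using assms(2) i by (simp add: derivation_def nth_append)
    then show ?thesis
      by (rule step_ok_mono) auto
  qed
qed

lemma derivation_snoc:
  assumes "derivation D P" and "step_ok D (set P) L"
  shows "derivation D (P @ [L])"
  using assms by (auto simp: derivation_def nth_append less_Suc_eq)

lemma finite_derivable_set:
  assumes "finite S" and "\<forall>L\<in>S. D \<turnstile> L"
  obtains P where "derivation D P" "S \<subseteq> set P"
proof -
  have "\<exists>P. derivation D P \<and> S \<subseteq> set P"
    using assms
  proof induction
    case empty
    have "derivation D []"
      by (simp add: derivation_def)
    then show ?case
      by auto
  next
    case (insert L S)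
    then obtain P P' where P: "derivation D P" "S \<subseteq> set P" "derivation D P'" "L \<in> set P'"
      by (auto simp: derivable_def)
    then have "derivation D (P @ P')"
      by (intro derivation_append)
    moreover have "insert L S \<subseteq> set (P @ P')"
      using P by auto
    ultimately show ?case
      by blast
  qed
  then show thesis
    using that by blast
qed

text \<open>Lets the conditions be evaluated in the set of all derivable tagged literals, without
  building sequences. That set may be infinite while a derivation is finite, hence the passage
  through a finite support.\<close>

lemma derivable_if_step_ok:
  assumes "defeasible_theory D" and "step_ok D {L. D \<turnstile> L} L"
  shows "D \<turnstile> L"
proof -
  obtain S where S: "finite S" "S \<subseteq> {L. D \<turnstile> L}" "step_ok D S L"
    using step_ok_finite_support[OF assms] .
  obtain P where P: "derivation D P" "S \<subseteq> set P"
    using finite_derivable_set[of S D] S by blast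
  then have "derivation D (P @ [L])"
    using S step_ok_mono by (blast intro: derivation_snoc)
  then show ?thesis
    by (auto simp: derivable_def)
qed

lemma wf_DG_arcs:
  assumes "defeasible_theory D" and "decisive D"
  shows "wf ((snd (DG D))\<inverse>)"
proof (rule finite_acyclic_wf_converse)
  \<comment> \<open>Each arc is determined by a rule and one of its antecedents.\<close>
  have "snd (DG D) \<subseteq> (\<Union>r\<in>rules D. (\<lambda>a. ({head r, compl (head r)}, {a, compl a})) ` ante r)"
    by (auto simp: DG_def R_def)
  moreover have "finite \<dots>"
    using assms(1) by (simp add: defeasible_theory_def)
  ultimately show "finite (snd (DG D))"
    by (rule finite_subset)
  show "acyclic (snd (DG D))"
    using assms(2) by (simp add: decisive_def)
qed

text \<open>Arcs run from heads to antecedents, so antecedents are the smaller elements. A graph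
  point holds \<open>q\<close> and \<open>compl q\<close> together, so the hypothesis also covers
  the rules attacking \<open>q\<close>.\<close>

lemma decisive_induct [consumes 2, case_names step]:
  assumes "defeasible_theory D" and "decisive D"
    and step: "\<And>q. (\<And>r a. r \<in> R D q \<union> R D (compl q) \<Longrightarrow> a \<in> ante r \<Longrightarrow> Q a) \<Longrightarrow> Q q"
  shows "Q q"
  using wf_inv_image[OF wf_DG_arcs[OF assms(1,2)], of "\<lambda>q. {q, compl q}"]
proof (induction q)
  case (less q)
  show ?case
  proof (rule step)
    fix r a assume r: "r \<in> R D q \<union> R D (compl q)" "a \<in> ante r"
    have "{compl q, compl (compl q)} = {q, compl q}"
      by auto
    then have "({q, compl q}, {a, compl a}) \<in> snd (DG D)"
      using r unfolding DG_def snd_conv by blast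
    then show "Q a"
      using less by (simp add: in_inv_image)
  qed
qed

lemma Delta_decided:
  assumes D: "defeasible_theory D" and "decisive D"
  shows "D \<turnstile> +\<Delta> q \<or> D \<turnstile> -\<Delta> q"
  using assms
proof (induction rule: decisive_induct)
  case (step q)
  from step have "D \<turnstile> +\<Delta> a \<or> D \<turnstile> -\<Delta> a" if "r \<in> R_s D q" "a \<in> ante r" for r a
    using that by (auto simp: R_s_def)
  \<comment> \<open>If the condition for \<open>+\<Delta> q\<close> fails, every strict rule for
    \<open>q\<close> has an antecedent without derivable \<open>+\<Delta>\<close>, hence with
    derivable \<open>-\<Delta>\<close>.\<close>
  then have "step_ok D {L. D \<turnstile> L} (+\<Delta> q) \<or> step_ok D {L. D \<turnstile> L} (-\<Delta> q)"
    by simp blast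
  then show ?case
    using derivable_if_step_ok[OF D] by blast
qed

lemma partial_decided:
  assumes D: "defeasible_theory D" and "decisive D"
  shows "D \<turnstile> +\<partial> q \<or> D \<turnstile> -\<partial> q"
  using assms
proof (induction rule: decisive_induct)
  case (step q)
  \<comment> \<open>Each supporting or attacking rule is either applicable or discarded.\<close>
  have "(\<forall>a\<in>ante r. D \<turnstile> +\<partial> a) \<or> (\<exists>a\<in>ante r. D \<turnstile> -\<partial> a)"
    if "r \<in> R_sd D q \<or> r \<in> R D (compl q)" for r
    using step that by (auto simp: R_sd_def)
  \<comment> \<open>The conditions also consult \<open>\<Delta>\<close> tags of \<open>q\<close> and
    \<open>compl q\<close> themselves, which the induction hypothesis does not reach.\<close>
  moreover have "D \<turnstile> +\<Delta> q \<or> D \<turnstile> -\<Delta> q" "D \<turnstile> +\<Delta> (compl q) \<or> D \<turnstile> -\<Delta> (compl q)"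
    using Delta_decided[OF assms] by auto
  \<comment> \<open>A derivable \<open>+\<Delta> q\<close> gives \<open>+\<partial> q\<close> at
    once. Otherwise \<open>-\<Delta> q\<close> is derivable, and failure of one of the three
    conjuncts for \<open>+\<partial> q\<close> yields the matching disjunct for
    \<open>-\<partial> q\<close>.\<close>
  ultimately have "step_ok D {L. D \<turnstile> L} (+\<partial> q) \<or> step_ok D {L. D \<turnstile> L} (-\<partial> q)"
    unfolding step_ok.simps mem_Collect_eq by blast
  then show ?case
    using derivable_if_step_ok[OF D] by blast
qed

theorem theorem2p1:
  fixes D :: "('l, 'a) dtheory" and p :: "'a literal"
  assumes "defeasible_theory D"
    and "decisive D"
  shows "(D \<turnstile> +\<Delta> p \<or> D \<turnstile> -\<Delta> p) \<and> (D \<turnstile> +\<partial> p \<or> D \<turnstile> -\<partial> p)"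
  using Delta_decided[OF assms] partial_decided[OF assms] by blast

end
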